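(* Given a string $w\in\Sigma^*$ and an $\varepsilon$NFA $A=(Q,\Sigma,q_0,q_f,\delta)$ with $n$ states and $m$ transitions, one can decide in time $O(|w|+m)$ whether there exists a string $u$ that is a subsequence of $w$ with $u\in\mathcal{L}(A)$.
   Context: An $\varepsilon$NFA is a tuple $A=(Q,\Sigma,q_0,q_f,\delta)$ with finite state set $Q$, finite alphabet $\Sigma$, a single initial state $q_0$, a single final state $q_f$, and transitions $\delta\subseteq Q\times(\Sigma\cup\{\varepsilon\})\times Q$; $\mathcal{L}(A)$ is the set of strings labelling (ignoring $\varepsilon$) a path from $q_0$ to $q_f$. Standing assumptions: $A$ is trimmed (every state is reachable from $q_0$ and can reach $q_f$) and every symbol of $\Sigma$ labels at least one transition (so $n,|\Sigma|\in O(m)$). A string $u$ is a subsequence of $w$ if $u=w[j_1]\cdots w[j_{|u|}]$ for some $1\le j_1<\dots<j_{|u|}\le|w|$. Model: unit-cost word RAM with logarithmic word size; the alphabet is an integer alphabet $\Sigma=\{1,\dots,|\Sigma|\}$ and $Q=\{1,\dots,n\}$ (the alphabet size is not assumed constant). *)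

theory Defs
  imports Complex_Main "HOL-Library.Sublist" "HOL-Library.Log_Nat"
begin

text \<open>A transition label \<open>None\<close> is the empty word; \<open>Some a\<close> is the symbol \<open>a\<close>.\<close>

record ('q, 'a) enfa =
  states :: "'q set"
  alphabet :: "'a set"
  initial :: 'q
  final :: 'q
  delta :: "('q \<times> 'a option \<times> 'q) set"

definition enfa :: "('q, 'a) enfa \<Rightarrow> bool" where
  "enfa A \<longleftrightarrow> finite (states A) \<and> finite (alphabet A) \<and>
     initial A \<in> states A \<and> final A \<in> states A \<and>
     delta A \<subseteq> states A \<times> insert None (Some ` alphabet A) \<times> states A"

inductive path :: "('q, 'a) enfa \<Rightarrow> 'q \<Rightarrow> 'a list \<Rightarrow> 'q \<Rightarrow> bool" for A where
  path_refl: "path A q [] q"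
| path_eps: "(p, None, q) \<in> delta A \<Longrightarrow> path A q u r \<Longrightarrow> path A p u r"
| path_sym: "(p, Some a, q) \<in> delta A \<Longrightarrow> path A q u r \<Longrightarrow> path A p (a # u) r"

definition language :: "('q, 'a) enfa \<Rightarrow> 'a list set" where
  "language A = {u. path A (initial A) u (final A)}"

definition trimmed :: "('q, 'a) enfa \<Rightarrow> bool" where
  "trimmed A \<longleftrightarrow>
     (\<forall>q\<in>states A. (\<exists>u. path A (initial A) u q) \<and> (\<exists>v. path A q v (final A)))"

definition all_symbols_used :: "('q, 'a) enfa \<Rightarrow> bool" where
  "all_symbols_used A \<longleftrightarrow> (\<forall>a\<in>alphabet A. \<exists>p q. (p, Some a, q) \<in> delta A)"

definition integer_enfa :: "(nat, nat) enfa \<Rightarrow> bool" where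
  "integer_enfa A \<longleftrightarrow> enfa A \<and> states A = {1..card (states A)} \<and>
     alphabet A = {1..card (alphabet A)}"

text \<open>
  A word of \<open>W\<close> bits is a natural number below \<open>2 ^ W\<close>; every value that is written is
  truncated by \<open>take_bit W\<close>. A program is a finite list of instructions, so it uses finitely
  many registers; memory is addressed by words held in registers.
\<close>

type_synonym reg = nat

datatype binop = Add | Sub | Mul | Div | Mod | And | Or | Xor | Shl | Shr

datatype instr =
    Const reg nat
  | Op binop reg reg reg
  | Load reg reg
  | Store reg reg
  | Jump nat
  | JumpEq reg reg nat
  | JumpLess reg reg nat

type_synonym program = "instr list"

record config =
  pc :: nat
  regs :: "reg \<Rightarrow> nat"
  mem :: "nat \<Rightarrow> nat"

text \<open>
  Subtraction is modulo \<open>2 ^ W\<close>. Division by zero follows the HOL convention: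
  \<open>x div 0 = 0\<close> and \<open>x mod 0 = x\<close>.
\<close>

fun binop_val :: "nat \<Rightarrow> binop \<Rightarrow> nat \<Rightarrow> nat \<Rightarrow> nat" where
  "binop_val W Add x y = take_bit W (x + y)"
| "binop_val W Sub x y = take_bit W (x + 2 ^ W - y)"
| "binop_val W Mul x y = take_bit W (x * y)"
| "binop_val W Div x y = take_bit W (x div y)"
| "binop_val W Mod x y = take_bit W (x mod y)"
| "binop_val W And x y = take_bit W (and x y)"
| "binop_val W Or x y = take_bit W (or x y)"
| "binop_val W Xor x y = take_bit W (xor x y)"
| "binop_val W Shl x y = take_bit W (push_bit y x)"
| "binop_val W Shr x y = take_bit W (drop_bit y x)"

fun exec :: "nat \<Rightarrow> instr \<Rightarrow> config \<Rightarrow> config" where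
  "exec W (Const d k) s = s\<lparr>pc := pc s + 1, regs := (regs s)(d := take_bit W k)\<rparr>"
| "exec W (Op f d a b) s =
     s\<lparr>pc := pc s + 1, regs := (regs s)(d := binop_val W f (regs s a) (regs s b))\<rparr>"
| "exec W (Load d a) s = s\<lparr>pc := pc s + 1, regs := (regs s)(d := mem s (regs s a))\<rparr>"
| "exec W (Store a b) s = s\<lparr>pc := pc s + 1, mem := (mem s)(regs s a := regs s b)\<rparr>"
| "exec W (Jump l) s = s\<lparr>pc := l\<rparr>"
| "exec W (JumpEq a b l) s = s\<lparr>pc := (if regs s a = regs s b then l else pc s + 1)\<rparr>"
| "exec W (JumpLess a b l) s = s\<lparr>pc := (if regs s a < regs s b then l else pc s + 1)\<rparr>"

definition halted :: "program \<Rightarrow> config \<Rightarrow> bool" where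
  "halted P s \<longleftrightarrow> pc s \<ge> length P"

definition step :: "nat \<Rightarrow> program \<Rightarrow> config \<Rightarrow> config" where
  "step W P s = (if halted P s then s else exec W (P ! pc s) s)"

text \<open>The input occupies the memory cells from address 0; everything else is zero.\<close>

definition start :: "nat \<Rightarrow> nat list \<Rightarrow> config" where
  "start W xs = \<lparr>pc = 0, regs = (\<lambda>_. 0),
     mem = (\<lambda>i. if i < length xs then take_bit W (xs ! i) else 0)\<rparr>"

text \<open>
  The program stops after at most \<open>T\<close> executed instructions and leaves the answer
  (1 for yes, 0 for no) in register 0.
\<close>

definition answers_within :: "nat \<Rightarrow> program \<Rightarrow> nat list \<Rightarrow> nat \<Rightarrow> bool \<Rightarrow> bool" where
  "answers_within W P xs T b \<longleftrightarrow>
     (\<exists>t\<le>T. halted P ((step W P ^^ t) (start W xs)) \<and>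
            regs ((step W P ^^ t) (start W xs)) 0 = (if b then 1 else 0))"

text \<open>
  \<open>I\<close> is the set of admissible instances, \<open>enc\<close> their encoding as a sequence of words,
  \<open>yes\<close> the problem and \<open>f\<close> the time bound. The word size is logarithmic:
  \<open>\<kappa>\<close> times the bit length of the input length, where a single program has to work for every
  sufficiently large constant \<open>\<kappa>\<close>. The bound \<open>O(f x)\<close> is read as \<open>c * f x + c\<close>, so that
  constant time is allowed on instances with \<open>f x = 0\<close>.
\<close>

definition decidable_in_time ::
    "'i set \<Rightarrow> ('i \<Rightarrow> nat list) \<Rightarrow> ('i \<Rightarrow> bool) \<Rightarrow> ('i \<Rightarrow> nat) \<Rightarrow> bool" where
  "decidable_in_time I enc yes f \<longleftrightarrow>
     (\<exists>P \<kappa>\<^sub>0 c. \<forall>\<kappa>\<ge>\<kappa>\<^sub>0. \<forall>x\<in>I.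
        answers_within (\<kappa> * floorlog 2 (length (enc x))) P (enc x) (c * f x + c) (yes x))"

text \<open>
  The transition set is given to the machine as a list without repetitions, in arbitrary order;
  the label 0, which is not a symbol, stands for the empty word.
\<close>

fun encode_transition :: "nat \<times> nat option \<times> nat \<Rightarrow> nat list" where
  "encode_transition (p, None, q) = [p, 0, q]"
| "encode_transition (p, Some a, q) = [p, a, q]"

type_synonym instance_data = "nat list \<times> (nat, nat) enfa \<times> (nat \<times> nat option \<times> nat) list"

definition instances :: "instance_data set" where
  "instances = {(w, A, ts). integer_enfa A \<and> trimmed A \<and> all_symbols_used A \<and>
     w \<in> lists (alphabet A) \<and> set ts = delta A \<and> distinct ts}"

fun encode :: "instance_data \<Rightarrow> nat list" where
  "encode (w, A, ts) =
     [length w, card (states A), card (alphabet A), card (delta A), initial A, final A]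
     @ w @ concat (map encode_transition ts)"

end

(*
  A state is reached after i symbols of w if some path from the initial state to it is labelled
  by a subsequence of the first i symbols. These sets grow with i, so one pass over w suffices if
  every transition is handled once: when its source is first reached it moves from the list of
  its source to the list of its label, where it waits for the next occurrence of that label in w;
  then it moves to a worklist, from which its target is reached. The worklist doubles as the list
  of the empty label. So each transition moves at most three times, and the total time is
  linear in the length of w plus the number of transitions.
*)

theory Submission imports Defs begin

text \<open>The obstacle is that rescanning the transitions for every symbol costs a product instead
  of a sum. Because symbols of \<open>w\<close> may be skipped, a state once reached stays reached;
  so a transition that has fired can be discarded for good. The delicate point is that a path may
  use one occurrence of a symbol only once. Hence the whole waiting list of that symbol is moved to
  the worklist before any transition is taken off the worklist. A transition that joins the same
  waiting list later has a source found only after this occurrence was read, and it has to wait for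
  the next one. Since the remaining symbols may also be skipped, the machine can answer yes as soon
  as the final state comes off the worklist. Zero-initialised memory makes all lists empty without a
  set-up pass. Correctness is argued on abstract lists \<open>L\<close>, which \<open>heap\<close>
  and \<open>store_ok\<close> tie to the memory; time is argued by a potential on the same
  lists.\<close>

text \<open>
  Transitions are identified with the address of their encoding. The lists are linked through the
  source field of the transitions, with null pointer 0, and their heads lie behind the input:
  register 5 is the base of the heads for states, register 6 the base of those for labels, hence
  also the head of the worklist. Cells 2 to 4 of the header serve as an extra transition with
  target \<open>initial A\<close>, which starts the search. Since a state's list is emptied when the
  state is reached and never refilled, no visited flags are needed.

  Registers 1, 2, 9, 14 hold 1, 2, 0, 3; 3 is the reading position, 4 the end of the word and 7
  the final state. The loops start at 17 (distribute the transitions to their sources),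
  25 (take a transition off the worklist), 33 (move the list of a state to the lists of the labels)
  and 48 (move the list of a symbol to the worklist).
\<close>

definition prog :: program where
  "prog =
    [Const 1 1, Const 2 2, Const 14 3, Const 3 6,
     Load 4 9, Op Add 4 4 3, Load 5 14, Op Mul 5 5 14, Op Add 5 5 4,
     Load 6 1, Op Add 6 6 5, Op Add 6 6 1, Const 7 5, Load 7 7,
     Store 2 9, Store 6 2, Op Add 8 4 9,
     JumpEq 8 5 25, Load 10 8, Op Add 10 10 5, Load 11 10, Store 8 11, Store 10 8,
     Op Add 8 8 14, Jump 17,
     Load 11 6, JumpEq 11 9 44, Load 12 11, Store 6 12, Op Add 11 11 2, Load 10 11,
     JumpEq 10 7 56, Op Add 10 10 5,
     Load 11 10, JumpEq 11 9 25, Op Add 13 11 1, Load 13 13, Op Add 12 13 6,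
     Load 13 11, Store 10 13, Load 13 12, Store 11 13, Store 12 11, Jump 33,
     JumpEq 3 4 57, Load 10 3, Op Add 10 10 6, Op Add 3 3 1,
     Load 11 10, JumpEq 11 9 25, Load 13 11, Store 10 13, Load 13 6, Store 11 13, Store 6 11,
     Jump 48,
     Const 0 1]"

section \<open>Running the program symbolically, and counting rounds by a potential\<close>

lemma length_prog: "length prog = 57"
  by (simp add: prog_def)

lemma fetch:
  "prog ! 0 = Const 1 1" "prog ! 1 = Const 2 2" "prog ! 2 = Const 14 3" "prog ! 3 = Const 3 6"
  "prog ! 4 = Load 4 9" "prog ! 5 = Op Add 4 4 3" "prog ! 6 = Load 5 14"
  "prog ! 7 = Op Mul 5 5 14" "prog ! 8 = Op Add 5 5 4"
  "prog ! 9 = Load 6 1" "prog ! 10 = Op Add 6 6 5" "prog ! 11 = Op Add 6 6 1"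
  "prog ! 12 = Const 7 5" "prog ! 13 = Load 7 7"
  "prog ! 14 = Store 2 9" "prog ! 15 = Store 6 2" "prog ! 16 = Op Add 8 4 9"
  "prog ! 17 = JumpEq 8 5 25" "prog ! 18 = Load 10 8" "prog ! 19 = Op Add 10 10 5"
  "prog ! 20 = Load 11 10" "prog ! 21 = Store 8 11" "prog ! 22 = Store 10 8"
  "prog ! 23 = Op Add 8 8 14" "prog ! 24 = Jump 17"
  "prog ! 25 = Load 11 6" "prog ! 26 = JumpEq 11 9 44" "prog ! 27 = Load 12 11"
  "prog ! 28 = Store 6 12" "prog ! 29 = Op Add 11 11 2" "prog ! 30 = Load 10 11"
  "prog ! 31 = JumpEq 10 7 56" "prog ! 32 = Op Add 10 10 5"
  "prog ! 33 = Load 11 10" "prog ! 34 = JumpEq 11 9 25" "prog ! 35 = Op Add 13 11 1"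
  "prog ! 36 = Load 13 13" "prog ! 37 = Op Add 12 13 6"
  "prog ! 38 = Load 13 11" "prog ! 39 = Store 10 13" "prog ! 40 = Load 13 12"
  "prog ! 41 = Store 11 13" "prog ! 42 = Store 12 11" "prog ! 43 = Jump 33"
  "prog ! 44 = JumpEq 3 4 57" "prog ! 45 = Load 10 3" "prog ! 46 = Op Add 10 10 6"
  "prog ! 47 = Op Add 3 3 1"
  "prog ! 48 = Load 11 10" "prog ! 49 = JumpEq 11 9 25" "prog ! 50 = Load 13 11"
  "prog ! 51 = Store 10 13" "prog ! 52 = Load 13 6" "prog ! 53 = Store 11 13"
  "prog ! 54 = Store 6 11" "prog ! 55 = Jump 48" "prog ! 56 = Const 0 1"
  by (simp_all add: prog_def)

lemma step_prog: "pc s < 57 \<Longrightarrow> step W prog s = exec W (prog ! pc s) s"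
  by (simp add: step_def halted_def length_prog)

text \<open>Together with \<open>funpow_Suc_apply\<close> this peels off the innermost application,
  so the simplifier runs the program forwards: each state is explicit before the next instruction is
  fetched.\<close>

lemma funpow_numeral: "(f ^^ numeral k) x = (f ^^ pred_numeral k) (f x)"
  by (simp add: numeral_eq_Suc funpow_swap1)

lemma funpow_Suc_apply: "(f ^^ Suc k) x = (f ^^ k) (f x)"
  by (simp add: funpow_swap1)

lemmas run_simps = funpow_numeral funpow_Suc_apply step_prog fetch

text \<open>Time is charged per round of at most \<open>K\<close> steps instead of per step. An
  invariant is then needed only at loop heads, and there are at most \<open>\<nu> + 1\<close>
  rounds.\<close>

lemma run_with_potential:
  assumes step: "\<And>s \<nu>. Inv s \<nu> \<Longrightarrow>
      \<exists>k\<le>K. good ((F ^^ k) s) \<or> (\<exists>\<nu>'<\<nu>. Inv ((F ^^ k) s) \<nu>')"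
    and "Inv s (\<nu> :: nat)"
  shows "\<exists>t\<le>K * (\<nu> + 1). good ((F ^^ t) s)"
  using assms(2)
proof (induction \<nu> arbitrary: s rule: less_induct)
  case (less \<nu>)
  obtain k where k: "k \<le> K" "good ((F ^^ k) s) \<or> (\<exists>\<nu>'<\<nu>. Inv ((F ^^ k) s) \<nu>')"
    using step[OF less.prems] by blast
  from k(2) show ?case
  proof
    assume "good ((F ^^ k) s)"
    moreover have "k \<le> K * (\<nu> + 1)" using k(1) by (simp add: trans_le_add1)
    ultimately show ?thesis by blast
  next
    assume "\<exists>\<nu>'<\<nu>. Inv ((F ^^ k) s) \<nu>'"
    then obtain \<nu>' where v: "\<nu>' < \<nu>" "Inv ((F ^^ k) s) \<nu>'" by blast
    from less.IH[OF this] obtain t where t: "t \<le> K * (\<nu>' + 1)" "good ((F ^^ t) ((F ^^ k) s))"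
      by blast
    have "K * (\<nu>' + 1) \<le> K * \<nu>" using v(1) by (intro mult_le_mono2) simp
    then have "t + k \<le> K * (\<nu> + 1)" using t(1) k(1) by simp
    moreover have "good ((F ^^ (t + k)) s)" using t(2) by (simp add: funpow_add)
    ultimately show ?thesis by blast
  qed
qed

section \<open>Paths and the states reachable by subsequences\<close>

lemma path_append: "path A p u q \<Longrightarrow> path A q v r \<Longrightarrow> path A p (u @ v) r"
  by (induction rule: path.induct) (auto intro: path.intros)

lemma path_snoc_eps: "path A p u q \<Longrightarrow> (q, None, r) \<in> delta A \<Longrightarrow> path A p u r"
  using path_append[of A p u q "[]" r] by (auto intro: path.intros)

lemma path_snoc_sym: "path A p u q \<Longrightarrow> (q, Some a, r) \<in> delta A \<Longrightarrow> path A p (u @ [a]) r"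
  using path_append[of A p u q "[a]" r] by (auto intro: path.intros)

lemma path_snocD:
  "path A p x q \<Longrightarrow> x = u @ [a] \<Longrightarrow>
    \<exists>p' q'. path A p u p' \<and> (p', Some a, q') \<in> delta A \<and> path A q' [] q"
proof (induction arbitrary: u rule: path.induct)
  case (path_refl q)
  then show ?case by simp
next
  case (path_eps p q x r)
  then show ?case using path.path_eps[OF path_eps.hyps(1)] by blast
next
  case (path_sym p b q x r)
  show ?case
  proof (cases u)
    case Nil
    with path_sym show ?thesis by (auto intro: path.intros)
  next
    case (Cons c v)
    with path_sym show ?thesis by (auto intro: path.intros)
  qed
qed

lemma path_eps_closed:
  assumes "path A p x q" "x = []" "p \<in> V"
    and "\<And>p q. p \<in> V \<Longrightarrow> (p, None, q) \<in> delta A \<Longrightarrow> q \<in> V"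
  shows "q \<in> V"
  using assms by (induction rule: path.induct) auto

definition sub_reach :: "('q, 'a) enfa \<Rightarrow> 'a list \<Rightarrow> 'q set" where
  "sub_reach A x = {q. \<exists>u. subseq u x \<and> path A (initial A) u q}"

lemma initial_sub_reach: "initial A \<in> sub_reach A x"
  by (auto simp: sub_reach_def intro: path.intros exI[of _ "[]"])

lemma sub_reach_eps: "p \<in> sub_reach A x \<Longrightarrow> (p, None, q) \<in> delta A \<Longrightarrow> q \<in> sub_reach A x"
  by (auto simp: sub_reach_def intro: path_snoc_eps)

lemma sub_reach_mono: "sub_reach A x \<subseteq> sub_reach A (x @ [a])"
  by (auto simp: sub_reach_def)

lemma sub_reach_sym:
  assumes "p \<in> sub_reach A x" "(p, Some a, q) \<in> delta A"
  shows "q \<in> sub_reach A (x @ [a])"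
proof -
  obtain u where u: "subseq u x" "path A (initial A) u p"
    using assms(1) by (auto simp: sub_reach_def)
  then have "subseq (u @ [a]) (x @ [a])" "path A (initial A) (u @ [a]) q"
    using assms(2) by (auto intro: path_snoc_sym)
  then show ?thesis unfolding sub_reach_def by blast
qed

lemma sub_reach_Nil_subset:
  assumes "initial A \<in> V" "\<And>p q. p \<in> V \<Longrightarrow> (p, None, q) \<in> delta A \<Longrightarrow> q \<in> V"
  shows "sub_reach A [] \<subseteq> V"
  using assms by (auto simp: sub_reach_def dest: path_eps_closed)

text \<open>A subsequence of \<open>x @ [a]\<close> that is not one of \<open>x\<close> ends in the
  new \<open>a\<close>; its path crosses an \<open>a\<close>-transition out of
  \<open>sub_reach A x\<close> and then only empty labels. Thus \<open>sym\<close> asks for sources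
  in \<open>sub_reach A x\<close>, not in \<open>V\<close>: the new occurrence is used at most
  once.\<close>

lemma sub_reach_snoc_subset:
  assumes prev: "sub_reach A x \<subseteq> V"
    and eps: "\<And>p q. p \<in> V \<Longrightarrow> (p, None, q) \<in> delta A \<Longrightarrow> q \<in> V"
    and sym: "\<And>p q. p \<in> sub_reach A x \<Longrightarrow> (p, Some a, q) \<in> delta A \<Longrightarrow> q \<in> V"
  shows "sub_reach A (x @ [a]) \<subseteq> V"
proof
  fix q assume "q \<in> sub_reach A (x @ [a])"
  then obtain u where u: "subseq u (x @ [a])" "path A (initial A) u q"
    by (auto simp: sub_reach_def)
  show "q \<in> V"
  proof (cases "subseq u x")
    case True
    with u prev show ?thesis by (auto simp: sub_reach_def)
  next
    case False
    obtain v y where vy: "u = v @ y" "subseq v x" "subseq y [a]"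
      using u(1) by (auto simp: subseq_append_iff)
    then have "y = [a]"
      using False by (cases y) (auto split: if_splits)
    with vy have v: "u = v @ [a]" "subseq v x" by simp_all
    obtain p' q' where p: "path A (initial A) v p'" "(p', Some a, q') \<in> delta A" "path A q' [] q"
      using path_snocD[OF u(2) v(1)] by blast
    then have "p' \<in> sub_reach A x" using v by (auto simp: sub_reach_def)
    then have "q' \<in> V" using sym p by blast
    then show ?thesis using path_eps_closed[OF p(3)] eps by blast
  qed
qed

section \<open>Disjoint linked lists in memory\<close>

fun chain :: "(nat \<Rightarrow> nat) \<Rightarrow> nat \<Rightarrow> nat list \<Rightarrow> bool" where
  "chain m h [] \<longleftrightarrow> h = 0"
| "chain m h (x # xs) \<longleftrightarrow> h = x \<and> x \<noteq> 0 \<and> chain m (m x) xs"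

lemma chain_cong: "(\<And>x. x \<in> set xs \<Longrightarrow> m x = m' x) \<Longrightarrow> chain m h xs = chain m' h xs"
  by (induction xs arbitrary: h) auto

lemma chain_nonzero: "chain m h xs \<Longrightarrow> h \<noteq> 0 \<Longrightarrow> \<exists>ys. xs = h # ys"
  by (cases xs) auto

text \<open>\<open>H\<close> holds the head cells, \<open>E\<close> the possible nodes, and
  \<open>L\<close> the ghost contents. As in separation logic, distinctness within a list and
  disjointness between lists ensure that changing one link leaves the other chains intact.\<close>

definition heap :: "nat set \<Rightarrow> nat set \<Rightarrow> (nat \<Rightarrow> nat) \<Rightarrow> (nat \<Rightarrow> nat list) \<Rightarrow> bool" where
  "heap H E m L \<longleftrightarrow>
     (\<forall>c\<in>H. chain m (m c) (L c) \<and> set (L c) \<subseteq> E \<and> distinct (L c)) \<and>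
     (\<forall>c\<in>H. \<forall>d\<in>H. c \<noteq> d \<longrightarrow> set (L c) \<inter> set (L d) = {})"

lemma heap_pop:
  assumes h: "heap H E m L" and c: "c \<in> H" and L: "L c = x # xs" and disj: "H \<inter> E = {}"
  shows "heap H E (m(c := m x)) (L(c := xs))"
proof -
  have ch: "chain m (m x) xs" and "set (L c) \<subseteq> E" "distinct (L c)"
    using h c L unfolding heap_def by (fastforce, blast, blast)
  have "chain (m(c := m x)) ((m(c := m x)) d) ((L(c := xs)) d)" if d: "d \<in> H" for d
  proof -
    have "set ((L(c := xs)) d) \<subseteq> E"
      using h d \<open>set (L c) \<subseteq> E\<close> L by (auto simp: heap_def)
    then have "chain (m(c := m x)) h ((L(c := xs)) d) = chain m h ((L(c := xs)) d)" for h
      using c disj by (intro chain_cong) auto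
    then show ?thesis using h d ch by (auto simp: heap_def)
  qed
  moreover have "set ((L(c := xs)) d) \<subseteq> set (L d)" for d using L by auto
  moreover have "distinct ((L(c := xs)) d)" if "d \<in> H" for d
    using h that L \<open>distinct (L c)\<close> by (auto simp: heap_def)
  ultimately show ?thesis using h unfolding heap_def by (meson disjoint_iff subset_iff)
qed

lemma heap_push:
  assumes h: "heap H E m L" and d: "d \<in> H" and disj: "H \<inter> E = {}"
    and x: "x \<in> E" "x \<noteq> 0" and fresh: "\<And>c. c \<in> H \<Longrightarrow> x \<notin> set (L c)"
  shows "heap H E (m(x := m d, d := x)) (L(d := x # L d))"
proof -
  let ?m = "m(x := m d, d := x)"
  have "chain ?m h (L c) = chain m h (L c)" if "c \<in> H" for h c
    using h that fresh d disj by (intro chain_cong) (auto simp: heap_def)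
  then have "chain ?m (?m c) ((L(d := x # L d)) c)" if "c \<in> H" for c
    using that h d disj x by (auto simp: heap_def)
  then show ?thesis using h x fresh d unfolding heap_def by auto
qed

text \<open>A pop followed by a push, with the updates in the order of the stores of the program.
  Distinctness and disjointness make the popped node fresh for the push.\<close>

lemma heap_move:
  assumes h: "heap H E m L" and c: "c \<in> H" and d: "d \<in> H" "c \<noteq> d" and disj: "H \<inter> E = {}"
    and L: "L c = x # xs"
  shows "heap H E (m(c := m x, x := m d, d := x)) (L(c := xs, d := x # L d))"
proof -
  have x: "x \<in> E" "x \<noteq> 0" using h c L unfolding heap_def by fastforce+
  have fresh: "x \<notin> set ((L(c := xs)) b)" if "b \<in> H" for b
  proof (cases "b = c")
    case True
    then show ?thesis using h c L unfolding heap_def by fastforce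
  next
    case False
    then have "set (L c) \<inter> set (L b) = {}" using h c that by (auto simp: heap_def)
    moreover have "x \<in> set (L c)" using L by simp
    ultimately show ?thesis using False by auto
  qed
  have "(m(c := m x)) d = m d" "(L(c := xs)) d = L d" using d by simp_all
  from heap_push[OF heap_pop[OF h c L disj] d(1) disj x fresh, unfolded this] show ?thesis .
qed

section \<open>Encoding of instances, memory layout and word size\<close>

lemma encode_transition_eq: "encode_transition (p, l, q) = [p, case_option 0 id l, q]"
  by (cases l) auto

lemma length_encode_transition: "length (encode_transition t) = 3"
  by (cases t) (simp add: encode_transition_eq)

lemma length_encode_transitions: "length (concat (map encode_transition ts)) = 3 * length ts"
  by (induction ts) (auto simp: length_encode_transition)

lemma nth_encode_transitions:
  "k < length ts \<Longrightarrow> r < 3 \<Longrightarrow>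
    concat (map encode_transition ts) ! (3 * k + r) = encode_transition (ts ! k) ! r"
proof (induction ts arbitrary: k)
  case (Cons t ts)
  then show ?case
    by (cases k) (auto simp: nth_append length_encode_transition)
qed simp

text \<open>The first bound in \<open>wide\<close> makes room for the head cells behind the input,
  the second keeps the constants of the program from being truncated.\<close>

locale ram_run =
  fixes w :: "nat list" and A :: "(nat, nat) enfa" and ts :: "(nat \<times> nat option \<times> nat) list"
    and W :: nat
  assumes inst: "(w, A, ts) \<in> instances"
    and wide: "2 * length (encode (w, A, ts)) < 2 ^ W" "6 \<le> W"
begin

text \<open>The transitions occupy the cells from \<open>T\<close> up to \<open>B\<close>; state
  \<open>q\<close> has its head at \<open>B + q\<close>, label \<open>a\<close> at
  \<open>C + a\<close>. With 0 as the empty label, \<open>C\<close> is the worklist.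
  \<open>R i\<close> is the set that the search should have found after \<open>i\<close>
  symbols.\<close>

definition "m0 = mem (start W (encode (w, A, ts)))"
definition "T = 6 + length w"
definition "B = T + 3 * length ts"
definition "n = card (states A)"
definition "sg = card (alphabet A)"
definition "C = B + n + 1"
definition "E = (\<lambda>k. T + 3 * k) ` {..<length ts}"
definition "H = {B..C + sg}"
definition "R i = sub_reach A (take i w)"

lemma card_delta: "card (delta A) = length ts"
  using inst distinct_card[of ts] by (simp add: instances_def)

lemma A_facts:
  "finite (states A)" "finite (delta A)" "states A = {1..n}" "alphabet A = {1..sg}"
  "initial A \<in> {1..n}" "final A \<in> {1..n}" "set w \<subseteq> {1..sg}"
  "delta A \<subseteq> {1..n} \<times> insert None (Some ` {1..sg}) \<times> {1..n}"
  using inst unfolding instances_def integer_enfa_def enfa_def n_def sg_def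
  by (auto intro: List.finite_set dest: sym[of "set ts"] simp: in_lists_conv_set)

lemma set_ts: "set ts = delta A"
  using inst by (auto simp: instances_def)

text \<open>By trimmedness every state except the initial one is the target of a transition. Like
  \<open>sg_le\<close>, this serves the word size: the head cells occupy space linear in the
  input.\<close>

lemma n_le: "n \<le> length ts + 1"
proof -
  have "states A \<subseteq> insert (initial A) ((\<lambda>(p, l, q). q) ` delta A)"
  proof
    fix q assume "q \<in> states A"
    then obtain u where u: "path A (initial A) u q"
      using inst by (auto simp: instances_def trimmed_def)
    have "p = q \<or> q \<in> (\<lambda>(p, l, q). q) ` delta A" if "path A p u q" for p u
      using that by (induction rule: path.induct) force+
    with u show "q \<in> insert (initial A) ((\<lambda>(p, l, q). q) ` delta A)" by blast
  qed
  then have "card (states A) \<le> card (insert (initial A) ((\<lambda>(p, l, q). q) ` delta A))"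
    using A_facts by (intro card_mono) auto
  also have "\<dots> \<le> card ((\<lambda>(p, l, q). q) ` delta A) + 1"
    using A_facts by (simp add: card_insert_if)
  also have "\<dots> \<le> length ts + 1"
    using card_image_le[of "delta A" "\<lambda>(p, l, q). q"] A_facts card_delta by simp
  finally show ?thesis by (simp add: n_def)
qed

lemma sg_le: "sg \<le> length ts"
proof -
  have "Some ` alphabet A \<subseteq> (\<lambda>(p, l, q). l) ` delta A"
    using inst by (force simp: instances_def all_symbols_used_def)
  then have "card (Some ` alphabet A) \<le> card ((\<lambda>(p, l, q). l) ` delta A)"
    using A_facts by (intro card_mono) auto
  also have "\<dots> \<le> length ts"
    using card_image_le[of "delta A" "\<lambda>(p, l, q). l"] A_facts card_delta by simp
  finally show ?thesis by (simp add: sg_def card_image)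
qed

lemma length_encode: "length (encode (w, A, ts)) = B"
  by (simp add: length_encode_transitions B_def T_def)

lemma bound: "C + sg < 2 ^ W"
  using n_le sg_le wide(1) unfolding length_encode by (simp add: C_def B_def T_def)

lemma small: "x \<le> C + sg \<Longrightarrow> take_bit W x = x"
  using bound by (simp add: take_bit_nat_eq_self)

lemma small_const: "x < 64 \<Longrightarrow> take_bit W x = (x :: nat)"
proof -
  assume "x < (64 :: nat)"
  moreover have "(2 :: nat) ^ 6 \<le> 2 ^ W" using wide(2) by (intro power_increasing) auto
  ultimately show "take_bit W x = x" by (intro take_bit_nat_eq_self) simp
qed

text \<open>This ensures that \<open>start\<close> truncates no input value, so \<open>m0\<close> is
  the encoding itself.\<close>

lemma encode_le: "x \<in> set (encode (w, A, ts)) \<Longrightarrow> x \<le> C"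
proof -
  have "y \<le> C" if "t \<in> set ts" "y \<in> set (encode_transition t)" for t y
  proof -
    obtain p l q where t: "t = (p, l, q)" by (cases t)
    have "(p, l, q) \<in> {1..n} \<times> insert None (Some ` {1..sg}) \<times> {1..n}"
      using that t set_ts A_facts(8) by blast
    then show ?thesis using that t sg_le
      by (auto simp: encode_transition_eq C_def B_def)
  qed
  moreover have "x \<le> C" if "x \<in> set w" for x
    using that A_facts(7) sg_le by (force simp: C_def B_def)
  moreover have "length w \<le> C" "n \<le> C" "sg \<le> C" "length ts \<le> C" "initial A \<le> C" "final A \<le> C"
    using A_facts sg_le by (auto simp: C_def B_def T_def)
  ultimately show "x \<in> set (encode (w, A, ts)) \<Longrightarrow> x \<le> C"
    by (auto simp: card_delta n_def sg_def)
qed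

lemma m0_encode: "i < B \<Longrightarrow> m0 i = encode (w, A, ts) ! i"
  unfolding m0_def start_def using length_encode encode_le[OF nth_mem, of i]
  by (auto simp del: encode.simps intro!: small)

lemma m0_zero: "i \<ge> B \<Longrightarrow> m0 i = 0"
  by (simp add: m0_def start_def length_encode del: encode.simps)

lemma m0_header:
  "m0 0 = length w" "m0 (Suc 0) = n" "m0 3 = length ts" "m0 4 = initial A" "m0 5 = final A"
  using m0_encode[of 0] m0_encode[of 1] m0_encode[of 3] m0_encode[of 4] m0_encode[of 5]
  by (auto simp: B_def T_def n_def card_delta)

lemma m0_word: "j < length w \<Longrightarrow> m0 (6 + j) = w ! j"
  using m0_encode[of "6 + j"] by (auto simp: B_def T_def nth_append)

lemma m0_transition:
  assumes "k < length ts" "ts ! k = (p, l, q)"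
  shows "m0 (T + 3 * k) = p" "m0 (T + 3 * k + 1) = case_option 0 id l" "m0 (T + 3 * k + 2) = q"
proof -
  have *: "m0 (T + 3 * k + r) = encode_transition (ts ! k) ! r" if "r < 3" for r
  proof -
    have "T + 3 * k + r < B" using assms that by (simp add: B_def)
    \<comment> \<open>Header and word are grouped into one prefix of length \<open>T\<close>, so
      that \<open>nth_append\<close> leaves the index \<open>3 * k + r\<close> within the
      transitions.\<close>
    then have "m0 (T + 3 * k + r) = (([length w, card (states A), card (alphabet A),
        card (delta A), initial A, final A] @ w) @ concat (map encode_transition ts)) ! (T + (3 * k + r))"
      by (simp only: m0_encode encode.simps append_assoc add.assoc)
    also have "\<dots> = concat (map encode_transition ts) ! (3 * k + r)"
      unfolding nth_append by (simp add: T_def)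
    finally show ?thesis using nth_encode_transitions[OF assms(1) that] by simp
  qed
  show "m0 (T + 3 * k) = p" "m0 (T + 3 * k + 1) = case_option 0 id l" "m0 (T + 3 * k + 2) = q"
    using *[of 0] *[of 1] *[of 2] assms(2) by (simp_all add: encode_transition_eq)
qed

lemma edge_address:
  assumes "e \<in> E"
  shows "m0 e \<in> {1..n}" "m0 (e + 2) \<in> {1..n}" "m0 (e + 1) \<le> sg"
    "m0 (e + 1) = 0 \<Longrightarrow> (m0 e, None, m0 (e + 2)) \<in> delta A"
    "m0 (e + 1) \<noteq> 0 \<Longrightarrow> (m0 e, Some (m0 (e + 1)), m0 (e + 2)) \<in> delta A"
proof -
  obtain k where k: "k < length ts" "e = T + 3 * k" using assms by (auto simp: E_def)
  obtain p l q where t: "ts ! k = (p, l, q)" by (cases "ts ! k")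
  have d: "(p, l, q) \<in> delta A" using k t set_ts by (metis nth_mem)
  then have "(p, l, q) \<in> {1..n} \<times> insert None (Some ` {1..sg}) \<times> {1..n}" using A_facts by blast
  then show "m0 e \<in> {1..n}" "m0 (e + 2) \<in> {1..n}" "m0 (e + 1) \<le> sg"
    "m0 (e + 1) = 0 \<Longrightarrow> (m0 e, None, m0 (e + 2)) \<in> delta A"
    "m0 (e + 1) \<noteq> 0 \<Longrightarrow> (m0 e, Some (m0 (e + 1)), m0 (e + 2)) \<in> delta A"
    unfolding k(2) m0_transition[OF k(1) t] using d by auto
qed

lemma transition_address:
  assumes "(p, l, q) \<in> delta A"
  obtains e where "e \<in> E" "m0 e = p" "m0 (e + 1) = case_option 0 id l" "m0 (e + 2) = q"
proof -
  obtain k where k: "k < length ts" "ts ! k = (p, l, q)"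
    using assms set_ts by (metis in_set_conv_nth)
  then show ?thesis using that[of "T + 3 * k"] m0_transition[OF k] by (auto simp: E_def)
qed

text \<open>Link cells lie at distance 0 modulo 3 from \<open>T\<close>, label and target fields at
  1 and 2, and the fields 3 and 4 of the extra transition lie in the header. So links never
  overwrite these fields, and 0 is free as null pointer.\<close>

lemma edge_slot:
  assumes "e \<in> insert 2 E"
  shows "e + 2 < B" "e + 1 \<notin> insert 2 E" "e + 2 \<notin> insert 2 E" "e \<noteq> 0"
proof -
  have "(3 * k + 1) mod 3 = 1" "(3 * k + 2) mod 3 = 2" "(3 * k) mod 3 = 0" for k :: nat
    by presburger+
  then have "3 * k + 1 \<noteq> 3 * j" "3 * k + 2 \<noteq> 3 * j" for k j :: nat by presburger+
  then show "e + 2 < B" "e + 1 \<notin> insert 2 E" "e + 2 \<notin> insert 2 E" "e \<noteq> 0"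
    using assms by (auto simp: E_def B_def T_def)
qed

lemma H_disjoint: "H \<inter> insert 2 E = {}"
  using edge_slot by (force simp: H_def)

lemma word_slot: "j < length w \<Longrightarrow> 6 + j < B \<and> 6 + j \<notin> insert 2 E"
  by (auto simp: E_def B_def T_def)

section \<open>Invariant of the search on abstract lists\<close>

lemma R_subset_states: "R i \<subseteq> {1..n}"
proof -
  have "q \<in> {1..n}" if "path A p u q" "p \<in> {1..n}" for p u q
    using that A_facts(8) by (induction rule: path.induct) auto
  then show ?thesis using A_facts(5) unfolding R_def sub_reach_def by blast
qed

lemma R_Suc: "i < length w \<Longrightarrow> R (Suc i) = sub_reach A (take i w @ [w ! i])"
  by (simp add: R_def take_Suc_conv_app_nth)

lemma word_symbol: "i < length w \<Longrightarrow> w ! i \<in> {1..sg}"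
  using A_facts(7) nth_mem by blast

text \<open>
  \<open>b\<close> is the state whose list is being emptied; 0, which is not a state, stands for none.
\<close>

definition search_inv :: "nat set \<Rightarrow> nat \<Rightarrow> (nat \<Rightarrow> nat list) \<Rightarrow> nat \<Rightarrow> bool" where
  "search_inv V i L b \<longleftrightarrow> i \<le> length w \<and> V \<subseteq> R i \<and> final A \<notin> V \<and>
     (2 \<in> set (L C) \<or> initial A \<in> V) \<and>
     (\<forall>e\<in>set (L C). m0 (e + 2) \<in> R i) \<and>
     (\<forall>q\<in>{1..n}. \<forall>e\<in>set (L (B + q)). e \<in> E \<and> m0 e = q) \<and>
     (\<forall>a\<in>{1..sg}. \<forall>e\<in>set (L (C + a)). e \<in> E \<and> m0 (e + 1) = a \<and> m0 e \<in> V) \<and>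
     (\<forall>e\<in>E. e \<in> set (L (B + m0 e)) \<or>
        m0 e \<in> V \<and> (e \<in> set (L (C + m0 (e + 1))) \<or> e \<in> set (L C) \<or> m0 (e + 2) \<in> V)) \<and>
     (\<forall>q\<in>V. q \<noteq> b \<longrightarrow> L (B + q) = [])"

text \<open>The part of completeness that concerns the last symbol read. It is kept apart from
  \<open>search_inv\<close> because it fails while the list of that symbol is still being moved.
  Sources range over \<open>R j\<close>, since \<open>V\<close> may already contain states that were
  found with this very symbol.\<close>

definition prefix_done :: "nat set \<Rightarrow> nat \<Rightarrow> (nat \<Rightarrow> nat list) \<Rightarrow> bool" where
  "prefix_done V i L \<longleftrightarrow> (\<forall>j. i = Suc j \<longrightarrow> R j \<subseteq> V \<and>
     (\<forall>e\<in>E. m0 e \<in> R j \<and> m0 (e + 1) = w ! j \<longrightarrow> e \<in> set (L C) \<or> m0 (e + 2) \<in> V))"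

lemma cells:
  "q \<in> {1..n} \<Longrightarrow> B + q \<noteq> C" "q \<in> {1..n} \<Longrightarrow> B + q \<noteq> C + a"
  "C \<in> H" "q \<in> {1..n} \<Longrightarrow> B + q \<in> H" "a \<le> sg \<Longrightarrow> C + a \<in> H"
  by (auto simp: C_def H_def)

text \<open>The target joins \<open>V\<close> before its own list is emptied, so the exception
  \<open>b\<close> passes from 0 to \<open>q\<close>.\<close>

lemma search_inv_pop:
  assumes J: "search_inv V i L 0" and L: "L C = e # es" and q: "m0 (e + 2) = q" "q \<noteq> final A"
  shows "search_inv (insert q V) i (L(C := es)) q"
proof -
  have qn: "q \<in> R i" using J L q by (auto simp: search_inv_def)
  have VR: "insert q V \<subseteq> R i" using qn J by (auto simp: search_inv_def)
  have b: "p \<in> {1..n} \<Longrightarrow> (L(C := es)) (B + p) = L (B + p)" for p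
    by (simp add: C_def)
  have s: "x \<in> set (L c) \<Longrightarrow> x \<in> set ((L(C := es)) c) \<or> x = e" for x c
    using L by auto
  have s': "set ((L(C := es)) c) \<subseteq> set (L c)" for c using L by auto
  have q0: "q \<noteq> 0" using qn R_subset_states[of i] by auto
  show ?thesis unfolding search_inv_def
  proof (intro conjI ballI impI)
    show "i \<le> length w" using J by (simp add: search_inv_def)
    show "insert q V \<subseteq> R i" by fact
    show "final A \<notin> insert q V" using J q by (simp add: search_inv_def)
    \<comment> \<open>The target field of the extra transition 2 is cell 4, which holds
      \<open>initial A\<close>.\<close>
    have "e = 2 \<Longrightarrow> q = initial A" using q m0_header by auto
    then show "2 \<in> set ((L(C := es)) C) \<or> initial A \<in> insert q V"
      using J L by (auto simp: search_inv_def)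
    show "m0 (x + 2) \<in> R i" if "x \<in> set ((L(C := es)) C)" for x
      using J L that by (auto simp: search_inv_def)
    show "x \<in> E" "m0 x = p" if "p \<in> {1..n}" "x \<in> set ((L(C := es)) (B + p))" for x p
      using J that s' unfolding search_inv_def by blast+
    show "x \<in> E" "m0 (x + 1) = a" "m0 x \<in> insert q V"
      if "a \<in> {1..sg}" "x \<in> set ((L(C := es)) (C + a))" for x a
      using J that s' unfolding search_inv_def by blast+
    show "x \<in> set ((L(C := es)) (B + m0 x)) \<or> m0 x \<in> insert q V \<and>
        (x \<in> set ((L(C := es)) (C + m0 (x + 1))) \<or> x \<in> set ((L(C := es)) C) \<or>
         m0 (x + 2) \<in> insert q V)" if "x \<in> E" for x
    proof -
      have "m0 x \<in> {1..n}" using edge_address[OF that] by simp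
      then show ?thesis using J that s q(1) b unfolding search_inv_def by (smt (verit, best) insert_iff)
    qed
    show "(L(C := es)) (B + p) = []" if "p \<in> insert q V" "p \<noteq> q" for p
    proof -
      have "p \<in> V" "p \<in> {1..n}" "p \<noteq> 0" using that VR R_subset_states[of i] by auto
      then show ?thesis using J b unfolding search_inv_def by metis
    qed
  qed
qed

lemma prefix_done_pop:
  assumes "prefix_done V i L" and "L C = e # es" and "m0 (e + 2) = q"
  shows "prefix_done (insert q V) i (L(C := es))"
proof -
  have "x = e \<or> x \<in> set es" if "x \<in> set (L C)" for x using that assms(2) by simp
  then show ?thesis using assms(1,3) unfolding prefix_done_def fun_upd_same by blast
qed

text \<open>For \<open>a = 0\<close> the transition lands on the worklist, whose targets must lie in
  \<open>R i\<close>; this is closure of \<open>sub_reach\<close> under empty labels. For a symbol,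
  only the fact that the source is in \<open>V\<close> has to be recorded.\<close>

lemma search_inv_walk:
  assumes J: "search_inv V i L q" and q: "q \<in> V" and L: "L (B + q) = e # es" and a: "m0 (e + 1) = a"
  shows "search_inv V i (L(B + q := es, C + a := e # L (C + a))) q" (is "search_inv V i ?L q")
proof -
  have VR: "V \<subseteq> R i" using J by (simp add: search_inv_def)
  have qn: "q \<in> {1..n}" using q VR R_subset_states by blast
  have e: "e \<in> E" "m0 e = q" using J qn L unfolding search_inv_def by auto
  have b: "?L (B + p) = (if p = q then es else L (B + p))" if "p \<in> {1..n}" for p
    using cells(2)[OF that, of a] by simp
  have c: "?L (C + d) = (if d = a then e # L (C + a) else L (C + d))" for d
    using cells(2)[OF qn, of d] by simp
  have c0: "?L C = (if a = 0 then e # L C else L C)" using c[of 0] by auto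
  have r: "m0 (e + 2) \<in> R i" if "a = 0"
  proof -
    have "(q, None, m0 (e + 2)) \<in> delta A" using edge_address(4)[OF e(1)] that a e(2) by simp
    moreover have "q \<in> sub_reach A (take i w)" using q VR by (auto simp: R_def)
    ultimately show ?thesis unfolding R_def by (rule sub_reach_eps[rotated])
  qed
  show ?thesis unfolding search_inv_def
  proof (intro conjI ballI impI)
    show "i \<le> length w" "V \<subseteq> R i" "final A \<notin> V" using J by (auto simp: search_inv_def)
    show "2 \<in> set (?L C) \<or> initial A \<in> V" using J c0 by (auto simp: search_inv_def)
    show "m0 (x + 2) \<in> R i" if "x \<in> set (?L C)" for x
      using J that r c0 unfolding search_inv_def by (auto split: if_splits)
    show "x \<in> E" "m0 x = p" if "p \<in> {1..n}" "x \<in> set (?L (B + p))" for x p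
      using J that L b[OF that(1)] unfolding search_inv_def by (auto split: if_splits)
    show "x \<in> E" "m0 (x + 1) = d" "m0 x \<in> V"
      if "d \<in> {1..sg}" "x \<in> set (?L (C + d))" for x d
    proof -
      have "x = e \<and> d = a \<or> x \<in> set (L (C + d))"
        using that(2) unfolding c by (auto split: if_splits)
      then show "x \<in> E" "m0 (x + 1) = d" "m0 x \<in> V"
        using J that(1) e q a unfolding search_inv_def by blast+
    qed
    show "x \<in> set (?L (B + m0 x)) \<or> m0 x \<in> V \<and>
        (x \<in> set (?L (C + m0 (x + 1))) \<or> x \<in> set (?L C) \<or> m0 (x + 2) \<in> V)" if "x \<in> E" for x
    proof (cases "x = e")
      case True
      then show ?thesis using e q a c by simp
    next
      case False
      have "m0 x \<in> {1..n}" using edge_address[OF that] by simp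
      from b[OF this] have "x \<in> set (L (B + m0 x)) \<Longrightarrow> x \<in> set (?L (B + m0 x))"
        using False L by (auto split: if_splits)
      moreover have "set (L (C + d)) \<subseteq> set (?L (C + d))" "set (L C) \<subseteq> set (?L C)" for d
        using c[of d] c0 by auto
      ultimately show ?thesis using J that unfolding search_inv_def by blast
    qed
    show "?L (B + p) = []" if "p \<in> V" "p \<noteq> q" for p
    proof -
      have "p \<in> {1..n}" using that VR R_subset_states[of i] by auto
      from b[OF this] that J show ?thesis by (simp add: search_inv_def)
    qed
  qed
qed

lemma prefix_done_mono: "prefix_done V i L \<Longrightarrow> set (L C) \<subseteq> set (L' C) \<Longrightarrow> prefix_done V i L'"
  unfolding prefix_done_def by blast

lemma search_inv_walk_end: "search_inv V i L q \<Longrightarrow> L (B + q) = [] \<Longrightarrow> search_inv V i L 0"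
  unfolding search_inv_def by (elim conjE, intro conjI, assumption+, metis)

lemma search_inv_edge:
  assumes J: "search_inv V i L 0" and "e \<in> E" "m0 e \<in> V"
  shows "e \<in> set (L (C + m0 (e + 1))) \<or> e \<in> set (L C) \<or> m0 (e + 2) \<in> V"
proof -
  have "m0 e \<noteq> 0" using edge_address(1)[OF assms(2)] by simp
  then have "L (B + m0 e) = []" using assms unfolding search_inv_def by blast
  then show ?thesis using assms unfolding search_inv_def by (metis empty_iff empty_set)
qed

text \<open>Soundness is part of the invariant. For completeness, an empty worklist leaves reached
  targets as the only option in \<open>search_inv_edge\<close> for empty labels and in
  \<open>prefix_done\<close> for the last symbol, so \<open>V\<close> has the closure properties
  that characterise \<open>R i\<close>.\<close>

lemma search_inv_empty:
  assumes J: "search_inv V i L 0" and p: "prefix_done V i L" and L: "L C = []"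
  shows "R i = V"
proof
  show "V \<subseteq> R i" using J by (simp add: search_inv_def)
  have eps: "q \<in> V" if pq: "p \<in> V" "(p, None, q) \<in> delta A" for p q
  proof -
    obtain e where e: "e \<in> E" "m0 e = p" "m0 (e + 1) = 0" "m0 (e + 2) = q"
      using transition_address[OF pq(2)] by auto
    \<comment> \<open>Label 0 makes the waiting list \<open>L (C + 0)\<close> the empty worklist
      itself.\<close>
    from search_inv_edge[OF J e(1)] show ?thesis using e pq(1) L by simp
  qed
  have init: "initial A \<in> V" using J L by (simp add: search_inv_def)
  show "R i \<subseteq> V"
  proof (cases i)
    case 0
    then show ?thesis using sub_reach_Nil_subset[of A V] eps init by (auto simp: R_def)
  next
    case (Suc j)
    then have j: "j < length w" using J by (simp add: search_inv_def)
    have "q \<in> V" if pq: "p \<in> R j" "(p, Some (w ! j), q) \<in> delta A" for p q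
    proof -
      obtain e where e: "e \<in> E" "m0 e = p" "m0 (e + 1) = w ! j" "m0 (e + 2) = q"
        using transition_address[OF pq(2)] by auto
      have "e \<in> set (L C) \<or> m0 (e + 2) \<in> V"
        using p e pq(1) unfolding Suc prefix_done_def by blast
      then show ?thesis using e L by simp
    qed
    then show ?thesis
      unfolding Suc R_Suc[OF j] using p eps Suc
      by (intro sub_reach_snoc_subset) (auto simp: prefix_done_def R_def)
  qed
qed

lemma R_mono: "i < length w \<Longrightarrow> R i \<subseteq> R (Suc i)"
  unfolding R_Suc by (simp add: R_def sub_reach_mono)

lemma search_inv_next: "search_inv V i L 0 \<Longrightarrow> i < length w \<Longrightarrow> search_inv V (Suc i) L 0"
  unfolding search_inv_def using R_mono by auto

text \<open>A waiting transition has its source in \<open>V\<close>. The bound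
  \<open>V \<subseteq> R i\<close>, sharper than the one inside the invariant for
  \<open>Suc i\<close>, shows that the symbol at position \<open>i\<close> is still available to
  it.\<close>

lemma search_inv_move:
  assumes J: "search_inv V (Suc i) L 0" and V: "V \<subseteq> R i" and i: "i < length w"
    and L: "L (C + w ! i) = e # es"
  shows "search_inv V (Suc i) (L(C + w ! i := es, C := e # L C)) 0" (is "search_inv V (Suc i) ?L 0")
proof -
  let ?a = "w ! i"
  have a: "?a \<in> {1..sg}" using word_symbol[OF i] .
  have e: "e \<in> E" "m0 (e + 1) = ?a" "m0 e \<in> V" using J L a unfolding search_inv_def by auto
  have b: "?L (B + p) = L (B + p)" if "p \<in> {1..n}" for p
    using cells(1,2)[OF that] by simp
  have c: "?L (C + d) = (if d = ?a then es else L (C + d))" if "d \<noteq> 0" for d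
    using that by simp
  have c0: "?L C = e # L C" by simp
  have r: "m0 (e + 2) \<in> R (Suc i)"
  proof -
    have "(m0 e, Some (w ! i), m0 (e + 2)) \<in> delta A"
      using edge_address(5)[OF e(1)] e(2) a by simp
    moreover have "m0 e \<in> sub_reach A (take i w)" using e(3) V by (auto simp: R_def)
    ultimately show ?thesis unfolding R_Suc[OF i] by (rule sub_reach_sym[rotated])
  qed
  show ?thesis unfolding search_inv_def
  proof (intro conjI ballI impI)
    show "Suc i \<le> length w" "V \<subseteq> R (Suc i)" "final A \<notin> V" using J by (auto simp: search_inv_def)
    show "2 \<in> set (?L C) \<or> initial A \<in> V" using J c0 by (auto simp: search_inv_def)
    show "m0 (x + 2) \<in> R (Suc i)" if "x \<in> set (?L C)" for x
      using J that r c0 unfolding search_inv_def by (auto split: if_splits)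
    show "x \<in> E" "m0 x = p" if "p \<in> {1..n}" "x \<in> set (?L (B + p))" for x p
      using J that b[OF that(1)] unfolding search_inv_def by auto
    show "x \<in> E" "m0 (x + 1) = d" "m0 x \<in> V"
      if "d \<in> {1..sg}" "x \<in> set (?L (C + d))" for x d
    proof -
      have "x \<in> set (L (C + d))" using that c[of d] L by (auto split: if_splits)
      then show "x \<in> E" "m0 (x + 1) = d" "m0 x \<in> V" using J that unfolding search_inv_def by auto
    qed
    show "x \<in> set (?L (B + m0 x)) \<or> m0 x \<in> V \<and>
        (x \<in> set (?L (C + m0 (x + 1))) \<or> x \<in> set (?L C) \<or> m0 (x + 2) \<in> V)" if "x \<in> E" for x
    proof (cases "x = e")
      case True
      then show ?thesis using e c0 by simp
    next
      case False
      have "m0 x \<in> {1..n}" using edge_address[OF that] by simp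
      from b[OF this] have "x \<in> set (L (B + m0 x)) \<Longrightarrow> x \<in> set (?L (B + m0 x))" by simp
      moreover have "x \<in> set (L (C + d)) \<Longrightarrow> x \<in> set (?L (C + d))"
        "x \<in> set (L C) \<Longrightarrow> x \<in> set (?L C)" for d
        using c[of d] c0 L False by (cases "d = 0"; auto)+
      ultimately show ?thesis using J that unfolding search_inv_def by blast
    qed
    show "?L (B + p) = []" if "p \<in> V" "p \<noteq> 0" for p
    proof -
      have "p \<in> {1..n}" using that V R_subset_states[of i] by auto
      from b[OF this] that J show ?thesis by (simp add: search_inv_def)
    qed
  qed
qed

text \<open>Every transition with this label and source in \<open>V\<close> has left its state list,
  and the waiting list is now empty too; so it is on the worklist or its target is reached.\<close>

lemma search_inv_move_end:
  assumes J: "search_inv V (Suc i) L 0" and V: "V = R i" and i: "i < length w"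
    and L: "L (C + w ! i) = []"
  shows "prefix_done V (Suc i) L"
  unfolding prefix_done_def
proof (intro allI impI conjI ballI)
  fix j e assume "Suc i = Suc j" "e \<in> E" "m0 e \<in> R j \<and> m0 (e + 1) = w ! j"
  then show "e \<in> set (L C) \<or> m0 (e + 2) \<in> V" using search_inv_edge[OF J, of e] L V by simp
qed (use V in simp)

lemma search_inv_start:
  assumes "L C = [2]" "\<And>a. a \<in> {1..sg} \<Longrightarrow> L (C + a) = []"
    and "\<And>q. q \<in> {1..n} \<Longrightarrow> set (L (B + q)) = {e \<in> E. m0 e = q}"
  shows "search_inv {} 0 L 0" "prefix_done {} 0 L"
proof -
  have "m0 (2 + 2) \<in> R 0" using m0_header initial_sub_reach by (simp add: R_def)
  then show "search_inv {} 0 L 0" unfolding search_inv_def using assms edge_address(1) by auto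
  show "prefix_done {} 0 L" by (simp add: prefix_done_def)
qed

section \<open>Effect of each straight-line piece of code, and the lists in machine memory\<close>

definition "regs_ok r \<longleftrightarrow> r 0 = (0 :: nat) \<and> r (1 :: nat) = 1 \<and> r 2 = 2 \<and> r 4 = T \<and> r 5 = B \<and>
  r 6 = C \<and> r 7 = final A \<and> r 9 = 0 \<and> r 14 = 3"

lemma small_sum: "x \<le> 7 + length w + 3 * length ts + n + sg \<Longrightarrow> take_bit W x = x"
  by (rule small) (simp add: C_def B_def T_def)

lemma start_eq: "start W (encode (w, A, ts)) = \<lparr>pc = 0, regs = \<lambda>_. 0, mem = m0\<rparr>"
  by (simp add: m0_def start_def)

text \<open>The deleted simp rules would rewrite \<open>take_bit W\<close> of these constants before
  \<open>small_const\<close> can evaluate it.\<close>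

lemma block_constants:
  "(step W prog ^^ 4) \<lparr>pc = 0, regs = r, mem = m\<rparr> =
     \<lparr>pc = 4, regs = r(1 := 1, 2 := 2, 14 := 3, 3 := 6), mem = m\<rparr>"
  by (simp add: eval_nat_numeral step_def halted_def prog_def small_const
      del: take_bit_of_1 take_bit_of_Suc_0 take_bit_of_2)

lemma block_init:
  defines "s \<equiv> (step W prog ^^ 17) (start W (encode (w, A, ts)))"
  shows "pc s = 17" "regs_ok (regs s)" "regs s 3 = 6" "regs s 8 = T" "mem s = m0(2 := 0, C := 2)"
proof -
  define r :: "nat \<Rightarrow> nat" where "r = (\<lambda>_. 0)(1 := 1, 2 := 2, 14 := 3, 3 := 6)"
  have r: "r 0 = 0" "r (Suc 0) = Suc 0" "r 2 = 2" "r 3 = 6" "r 9 = 0" "r 14 = 3"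
    by (simp_all add: r_def)
  have "s = (step W prog ^^ 13) \<lparr>pc = 4, regs = r, mem = m0\<rparr>"
    using funpow_add[of 13 4 "step W prog"] unfolding s_def start_eq r_def
    by (simp add: block_constants)
  also have "\<dots> = \<lparr>pc = 17,
      regs = r(4 := T, 5 := B, 6 := C, 7 := final A, 8 := T), mem = m0(2 := 0, C := 2)\<rparr>"
    unfolding C_def B_def T_def
    by (simp add: run_simps small_const small_sum m0_header r ac_simps)
  finally show "pc s = 17" "regs_ok (regs s)" "regs s 3 = 6" "regs s 8 = T"
    "mem s = m0(2 := 0, C := 2)"
    by (simp_all add: regs_ok_def r)
qed

lemma block_build:
  assumes "pc s = 17" "regs_ok (regs s)" "regs s 8 = T + 3 * k" "k < length ts"
    and "mem s (T + 3 * k) = q" "q \<le> n"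
  defines "s' \<equiv> (step W prog ^^ 8) s"
  shows "pc s' = 17" "regs_ok (regs s')" "regs s' 3 = regs s 3" "regs s' 8 = T + 3 * Suc k"
    "mem s' = (mem s)(T + 3 * k := mem s (B + q), B + q := T + 3 * k)"
  using assms(1-6) unfolding s'_def regs_ok_def C_def B_def T_def
  by (simp_all add: run_simps small_sum ac_simps)

lemma block_build_end:
  assumes "pc s = 17" "regs_ok (regs s)" "regs s 8 = B"
  shows "(step W prog ^^ 1) s = s\<lparr>pc := 25\<rparr>"
  using assms unfolding regs_ok_def by (simp add: run_simps)

lemma block_accept:
  assumes "pc s = 25" "regs_ok (regs s)" "mem s C = x" "x \<noteq> 0" "x + 2 < B"
    and "mem s (x + 2) = final A"
  defines "s' \<equiv> (step W prog ^^ 8) s"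
  shows "pc s' = 57" "regs s' 0 = 1"
  using assms(1-6) wide(2) small_sum[of "x + 2"] unfolding s'_def regs_ok_def C_def B_def T_def
  by (simp_all add: run_simps small_const)

lemma block_pop:
  assumes "pc s = 25" "regs_ok (regs s)" "mem s C = x" "x \<noteq> 0" "x + 2 < B"
    and "mem s (x + 2) = q" "q \<noteq> final A" "q \<le> n"
  defines "s' \<equiv> (step W prog ^^ 8) s"
  shows "pc s' = 33" "regs_ok (regs s')" "regs s' 3 = regs s 3" "regs s' 10 = B + q"
    "mem s' = (mem s)(C := mem s x)"
  using assms(1-8) small_sum[of "x + 2"] unfolding s'_def regs_ok_def C_def B_def T_def
  by (simp_all add: run_simps small_sum ac_simps)

lemma block_reject:
  assumes "pc s = 25" "regs_ok (regs s)" "mem s C = 0" "regs s 3 = T"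
  defines "s' \<equiv> (step W prog ^^ 3) s"
  shows "pc s' = 57" "regs s' 0 = 0"
  using assms(1-4) unfolding s'_def regs_ok_def
  by (simp_all add: run_simps)

lemma block_next:
  assumes "pc s = 25" "regs_ok (regs s)" "mem s C = 0" "regs s 3 = 6 + i" "i < length w"
    and "mem s (6 + i) = a" "a \<le> sg"
  defines "s' \<equiv> (step W prog ^^ 6) s"
  shows "pc s' = 48" "regs_ok (regs s')" "regs s' 3 = 6 + Suc i" "regs s' 10 = C + a"
    "mem s' = mem s"
  using assms(1-7) unfolding s'_def regs_ok_def C_def B_def T_def
  by (simp_all add: run_simps small_sum ac_simps)

text \<open>The condition \<open>c \<noteq> C + a\<close> matters because the program reads the head
  \<open>C + a\<close> after it has overwritten \<open>c\<close>.\<close>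

lemma block_walk:
  assumes "pc s = 33" "regs_ok (regs s)" "regs s 10 = c" "mem s c = x" "x \<noteq> 0" "x + 2 < B"
    and "mem s (x + 1) = a" "a \<le> sg" "c \<noteq> C + a"
  defines "s' \<equiv> (step W prog ^^ 11) s"
  shows "pc s' = 33" "regs_ok (regs s')" "regs s' 3 = regs s 3" "regs s' 10 = c"
    "mem s' = (mem s)(c := mem s x, x := mem s (C + a), C + a := x)"
  using assms(1-9) small_sum[of "x + 1"] unfolding s'_def regs_ok_def C_def B_def T_def
  by (simp_all add: run_simps small_sum ac_simps)

lemma block_walk_end:
  assumes "pc s = 33" "regs_ok (regs s)" "mem s (regs s 10) = 0"
  defines "s' \<equiv> (step W prog ^^ 2) s"
  shows "pc s' = 25" "regs_ok (regs s')" "regs s' 3 = regs s 3" "mem s' = mem s"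
  using assms(1-3) unfolding s'_def regs_ok_def
  by (simp_all add: run_simps)

lemma block_move:
  assumes "pc s = 48" "regs_ok (regs s)" "regs s 10 = c" "mem s c = x" "x \<noteq> 0" "c \<noteq> C"
  defines "s' \<equiv> (step W prog ^^ 8) s"
  shows "pc s' = 48" "regs_ok (regs s')" "regs s' 3 = regs s 3" "regs s' 10 = c"
    "mem s' = (mem s)(c := mem s x, x := mem s C, C := x)"
  using assms(1-6) unfolding s'_def regs_ok_def
  by (simp_all add: run_simps)

lemma block_move_end:
  assumes "pc s = 48" "regs_ok (regs s)" "mem s (regs s 10) = 0"
  defines "s' \<equiv> (step W prog ^^ 2) s"
  shows "pc s' = 25" "regs_ok (regs s')" "regs s' 3 = regs s 3" "mem s' = mem s"
  using assms(1-3) unfolding s'_def regs_ok_def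
  by (simp_all add: run_simps)

text \<open>The second conjunct is the frame condition: word, labels and targets keep their initial
  values. Source fields become links, hence the invariants refer to sources through
  \<open>m0\<close>.\<close>

definition "store_ok m L \<longleftrightarrow> heap H (insert 2 E) m L \<and> (\<forall>x<B. x \<notin> insert 2 E \<longrightarrow> m x = m0 x)"

lemma store_ok_pop:
  "store_ok m L \<Longrightarrow> c \<in> H \<Longrightarrow> L c = x # xs \<Longrightarrow> store_ok (m(c := m x)) (L(c := xs))"
  unfolding store_ok_def using heap_pop[OF _ _ _ H_disjoint] by (auto simp: H_def)

lemma store_ok_push:
  assumes "store_ok m L" "d \<in> H" "x \<in> insert 2 E" "\<And>c. c \<in> H \<Longrightarrow> x \<notin> set (L c)"
  shows "store_ok (m(x := m d, d := x)) (L(d := x # L d))"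
  using assms heap_push[OF _ assms(2) H_disjoint assms(3)] edge_slot(4)[OF assms(3)]
  unfolding store_ok_def by (auto simp: H_def)

lemma store_ok_move:
  assumes "store_ok m L" "c \<in> H" "d \<in> H" "c \<noteq> d" "L c = x # xs"
  shows "store_ok (m(c := m x, x := m d, d := x)) (L(c := xs, d := x # L d))"
proof -
  have h: "heap H (insert 2 E) m L" using assms(1) by (simp add: store_ok_def)
  have "x \<in> insert 2 E" using h assms(2,5) unfolding heap_def by fastforce
  then show ?thesis
    using heap_move[OF h assms(2-4) H_disjoint assms(5)] assms(1-3)
    unfolding store_ok_def by (auto simp: H_def)
qed

lemma store_ok_cell:
  assumes "store_ok m L" "c \<in> H"
  shows "m c = 0 \<longleftrightarrow> L c = []" "m c \<noteq> 0 \<Longrightarrow> \<exists>xs. L c = m c # xs \<and> m c \<in> insert 2 E"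
proof -
  have h: "chain m (m c) (L c)" "set (L c) \<subseteq> insert 2 E"
    using assms unfolding store_ok_def heap_def by auto
  show "m c = 0 \<longleftrightarrow> L c = []" using h(1) by (cases "L c") auto
  show "\<exists>xs. L c = m c # xs \<and> m c \<in> insert 2 E" if "m c \<noteq> 0"
    using chain_nonzero[OF h(1) that] h(2) by auto
qed

lemma store_ok_field:
  assumes "store_ok m L" "x \<in> insert 2 E"
  shows "m (x + 1) = m0 (x + 1)" "m (x + 2) = m0 (x + 2)"
  using assms edge_slot[OF assms(2)] unfolding store_ok_def by auto

section \<open>Potential and progress from one loop head to the next\<close>

text \<open>
  Each move of a transition (state list, label list, worklist, removed) lowers its weight; the
  final weight drop of 2 also pays for the exit from the loop at 33.
\<close>

definition "weight c = (if c = C then 2 else if c > C then 3 else 4 :: nat)"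

definition "pot L = (\<Sum>c\<in>H. weight c * length (L c))"

text \<open>Stated as a balance of sums to avoid truncated subtraction on natural numbers.\<close>

lemma pot_update:
  assumes "c \<in> H"
  shows "pot (L(c := xs)) + weight c * length (L c) = pot L + weight c * length xs"
proof -
  have "finite H" by (simp add: H_def)
  have "(\<Sum>d\<in>H - {c}. weight d * length ((L(c := xs)) d)) = (\<Sum>d\<in>H - {c}. weight d * length (L d))"
    by (intro sum.cong) auto
  then show ?thesis
    unfolding pot_def using \<open>finite H\<close> assms by (simp add: sum.remove[of H c])
qed

lemma pot_pop: "c \<in> H \<Longrightarrow> L c = x # xs \<Longrightarrow> pot (L(c := xs)) + weight c = pot L"
  using pot_update[of c L xs] by simp

lemma pot_push: "d \<in> H \<Longrightarrow> pot (L(d := x # L d)) = pot L + weight d"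
  using pot_update[of d L "x # L d"] by simp

lemma pot_move:
  assumes "c \<in> H" "d \<in> H" "c \<noteq> d" "L c = x # xs"
  shows "pot (L(c := xs, d := x # L d)) + weight c = pot L + weight d"
  using pot_pop[of c L x xs] pot_push[of d "L(c := xs)" x] assms by simp

definition "good s \<longleftrightarrow>
  halted prog s \<and> regs s 0 = (if final A \<in> R (length w) then 1 else 0)"

text \<open>A transition not yet distributed is worth 5: its weight 4 in a state list and 1 for the
  round. An unread symbol is worth 2, for entering and leaving the loop at 48. The final 1 pays for
  leaving the loop at 17.\<close>

definition "at_build s L \<nu> \<longleftrightarrow> (\<exists>k\<le>length ts. pc s = 17 \<and> regs s 3 = 6 \<and> regs s 8 = T + 3 * k \<and>
  L C = [2] \<and> (\<forall>a\<in>{1..sg}. L (C + a) = []) \<and>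
  (\<forall>q\<in>{1..n}. set (L (B + q)) = {T + 3 * j |j. j < k \<and> m0 (T + 3 * j) = q}) \<and>
  (\<forall>c\<in>H. set (L c) \<subseteq> insert 2 {T + 3 * j |j. j < k}) \<and>
  (\<forall>j. k \<le> j \<and> j < length ts \<longrightarrow> mem s (T + 3 * j) = m0 (T + 3 * j)) \<and>
  \<nu> = pot L + 5 * (length ts - k) + 2 * length w + 1)"

definition "at_drain s L \<nu> \<longleftrightarrow> (\<exists>V i. pc s = 25 \<and> regs s 3 = 6 + i \<and>
  search_inv V i L 0 \<and> prefix_done V i L \<and> \<nu> = pot L + 2 * (length w - i))"

definition "at_walk s L \<nu> \<longleftrightarrow> (\<exists>V i q. pc s = 33 \<and> regs s 3 = 6 + i \<and> regs s 10 = B + q \<and>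
  q \<in> V \<and> search_inv V i L q \<and> prefix_done V i L \<and> \<nu> = 1 + pot L + 2 * (length w - i))"

text \<open>The symbol counts as read on entry, so \<open>search_inv\<close> is already at
  \<open>Suc i\<close> while the reached set is still \<open>R i\<close>; \<open>prefix_done\<close>
  is restored only on exit.\<close>

definition "at_move s L \<nu> \<longleftrightarrow> (\<exists>i. pc s = 48 \<and> regs s 3 = 6 + Suc i \<and> i < length w \<and>
  regs s 10 = C + w ! i \<and> search_inv (R i) (Suc i) L 0 \<and> \<nu> = 1 + pot L + 2 * (length w - Suc i))"

definition "Inv s \<nu> \<longleftrightarrow> regs_ok (regs s) \<and> (\<exists>L. store_ok (mem s) L \<and>
  (at_build s L \<nu> \<or> at_drain s L \<nu> \<or> at_walk s L \<nu> \<or> at_move s L \<nu>))"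

text \<open>11 is the length of the longest piece, one pass through the loop at 33.\<close>

definition "progress s \<nu> \<longleftrightarrow> (\<exists>k\<le>11. good ((step W prog ^^ k) s) \<or>
  (\<exists>\<nu>'<\<nu>. Inv ((step W prog ^^ k) s) \<nu>'))"

lemma progressI:
  assumes "k \<le> 11" "regs_ok (regs s')" "store_ok (mem s') L" "s' = (step W prog ^^ k) s"
    and "at_build s' L \<nu>' \<or> at_drain s' L \<nu>' \<or> at_walk s' L \<nu>' \<or> at_move s' L \<nu>'" "\<nu>' < \<nu>"
  shows "progress s \<nu>"
  using assms unfolding progress_def Inv_def by blast

lemma progress_build:
  assumes r: "regs_ok (regs s)" and m: "store_ok (mem s) L" and b: "at_build s L \<nu>"
  shows "progress s \<nu>"
proof -
  obtain k where k: "k \<le> length ts" and s: "pc s = 17" "regs s 3 = 6" "regs s 8 = T + 3 * k"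
    and C: "L C = [2]" and a: "\<And>a. a \<in> {1..sg} \<Longrightarrow> L (C + a) = []"
    and q: "\<And>q. q \<in> {1..n} \<Longrightarrow> set (L (B + q)) = {T + 3 * j |j. j < k \<and> m0 (T + 3 * j) = q}"
    and H: "\<And>c. c \<in> H \<Longrightarrow> set (L c) \<subseteq> insert 2 {T + 3 * j |j. j < k}"
    and rest: "\<And>j. k \<le> j \<Longrightarrow> j < length ts \<Longrightarrow> mem s (T + 3 * j) = m0 (T + 3 * j)"
    and \<nu>: "\<nu> = pot L + 5 * (length ts - k) + 2 * length w + 1"
    using b unfolding at_build_def by blast
  show ?thesis
  proof (cases "k = length ts")
    case True
    have "set (L (B + q)) = {e \<in> E. m0 e = q}" if "q \<in> {1..n}" for q
      using q[OF that] True by (auto simp: E_def)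
    then have "search_inv {} 0 L 0" "prefix_done {} 0 L" using search_inv_start[of L] C a by auto
    moreover have "regs s 8 = B" using True s by (simp add: B_def)
    ultimately have "at_drain (s\<lparr>pc := 25\<rparr>) L (pot L + 2 * length w)"
      using s unfolding at_drain_def by (intro exI[of _ "{}"] exI[of _ 0]) simp
    then show ?thesis
      using r m \<nu> \<open>regs s 8 = B\<close>
      by (intro progressI[OF _ _ _ block_build_end[symmetric], of _ L]) (auto simp: s)
  next
    case False
    then have kl: "k < length ts" using k by simp
    let ?e = "T + 3 * k"
    let ?p = "m0 ?e"
    let ?s = "(step W prog ^^ 8) s"
    let ?L = "L(B + ?p := ?e # L (B + ?p))"
    have e: "?e \<in> E" using kl by (auto simp: E_def)
    then have p: "?p \<in> {1..n}" by (rule edge_address)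
    have d: "B + ?p \<in> H" using cells(4)[OF p] .
    note blk = block_build[OF s(1) r s(3) kl rest[OF order_refl kl]]
    \<comment> \<open>The new address differs from those of all earlier transitions, and from 2
      because \<open>T\<close> is at least 6.\<close>
    have fresh: "?e \<notin> set (L c)" if "c \<in> H" for c
      using H[OF that] by (auto simp: T_def)
    have Bp: "B + ?p \<noteq> T + 3 * j" if "j < length ts" for j
      using that by (auto simp: B_def)
    have mem: "mem ?s = (mem s)(?e := mem s (B + ?p), B + ?p := ?e)" using blk p by simp
    have "at_build ?s ?L (pot ?L + 5 * (length ts - Suc k) + 2 * length w + 1)"
      unfolding at_build_def
    proof (intro exI[of _ "Suc k"] conjI ballI allI impI)
      show "Suc k \<le> length ts" using kl by simp
      show "pc ?s = 17" "regs ?s 3 = 6" "regs ?s 8 = T + 3 * Suc k" using blk s p by auto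
      show "?L C = [2]" using C cells(1)[OF p] by simp
      show "?L (C + a) = []" if "a \<in> {1..sg}" for a
        using a[OF that] cells(2)[OF p, of a] by simp
      show "set (?L (B + q')) = {T + 3 * j |j. j < Suc k \<and> m0 (T + 3 * j) = q'}"
        if "q' \<in> {1..n}" for q'
        using q[OF that] by (auto simp: less_Suc_eq)
      show "set (?L c) \<subseteq> insert 2 {T + 3 * j |j. j < Suc k}" if "c \<in> H" for c
        using H[OF that] H[OF d] by (auto simp: less_Suc_eq)
      show "mem ?s (T + 3 * j) = m0 (T + 3 * j)" if "Suc k \<le> j \<and> j < length ts" for j
        unfolding mem using that rest[of j] Bp[of j] by auto
    qed simp
    moreover have "store_ok (mem ?s) ?L"
      unfolding mem using store_ok_push[OF m d _ fresh] e by blast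
    moreover have "pot ?L = pot L + 4"
      using pot_push[OF d] p by (simp add: weight_def C_def)
    ultimately show ?thesis
      using blk(2) p \<nu> kl by (intro progressI[of 8 ?s ?L]) auto
  qed
qed

text \<open>Skipping the rest of the word is allowed; this justifies accepting before it has been
  read.\<close>

lemma R_subset_final: "R i \<subseteq> R (length w)"
proof -
  have "subseq (take i w) w" by (simp add: prefix_imp_subseq take_is_prefix)
  then show ?thesis unfolding R_def sub_reach_def by (auto intro: subseq_order.trans)
qed

lemma progress_drain:
  assumes r: "regs_ok (regs s)" and m: "store_ok (mem s) L" and b: "at_drain s L \<nu>"
  shows "progress s \<nu>"
proof -
  obtain V i where s: "pc s = 25" "regs s 3 = 6 + i" and J: "search_inv V i L 0" and p: "prefix_done V i L"
    and \<nu>: "\<nu> = pot L + 2 * (length w - i)"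
    using b unfolding at_drain_def by blast
  have i: "i \<le> length w" and fin: "final A \<notin> V" using J by (auto simp: search_inv_def)
  note C = store_ok_cell[OF m cells(3)]
  show ?thesis
  proof (cases "mem s C = 0")
    case True
    then have L: "L C = []" using C by simp
    have V: "V = R i" using search_inv_empty[OF J p L] by simp
    show ?thesis
    proof (cases "i = length w")
      case at_end: True
      have "regs s 3 = T" using s at_end by (simp add: T_def)
      then have "good ((step W prog ^^ 3) s)"
        using block_reject[OF s(1) r True] fin V at_end by (simp add: good_def halted_def length_prog)
      then show ?thesis unfolding progress_def by (intro exI[of _ 3]) simp
    next
      case False
      then have i: "i < length w" using i by simp
      let ?s = "(step W prog ^^ 6) s"
      have "mem s (6 + i) = w ! i"
        using m word_slot[OF i] m0_word[OF i] unfolding store_ok_def by simp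
      note blk = block_next[OF s(1) r True s(2) i this]
      have a: "w ! i \<le> sg" using word_symbol[OF i] by simp
      have "at_move ?s L (1 + pot L + 2 * (length w - Suc i))"
        using blk a i search_inv_next[OF J i] V by (simp add: at_move_def)
      then show ?thesis
        using blk(2,5) a \<nu> m i by (intro progressI[of 6 ?s L]) auto
    qed
  next
    case False
    let ?x = "mem s C"
    let ?q = "m0 (?x + 2)"
    let ?s = "(step W prog ^^ 8) s"
    obtain xs where L: "L C = ?x # xs" and x: "?x \<in> insert 2 E" using C(2) False by blast
    have f: "mem s (?x + 2) = ?q" using store_ok_field[OF m x] by simp
    have qR: "?q \<in> R i" using J L by (simp add: search_inv_def)
    then have qn: "?q \<in> {1..n}" using R_subset_states by blast
    have xB: "?x + 2 < B" using edge_slot[OF x] by simp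
    show ?thesis
    proof (cases "?q = final A")
      case True
      then have "good ?s"
        using block_accept[OF s(1) r refl False xB] f qR R_subset_final[of i]
        by (auto simp: good_def halted_def length_prog)
      then show ?thesis unfolding progress_def by (intro exI[of _ 8]) simp
    next
      case nf: False
      note blk = block_pop[OF s(1) r refl False xB f nf]
      let ?L = "L(C := xs)"
      have "at_walk ?s ?L (1 + pot ?L + 2 * (length w - i))"
        unfolding at_walk_def
        using blk qn s search_inv_pop[OF J L refl nf] prefix_done_pop[OF p L refl]
        by (intro exI[of _ "insert ?q V"] exI[of _ i] exI[of _ ?q]) auto
      moreover have "store_ok (mem ?s) ?L"
        using blk(5) qn store_ok_pop[OF m cells(3) L] by simp
      moreover have "pot ?L + 2 = pot L" using pot_pop[of C L, OF cells(3) L] by (simp add: weight_def)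
      ultimately show ?thesis
        using blk(2) qn \<nu> by (intro progressI[of 8 ?s ?L]) auto
    qed
  qed
qed

lemma progress_walk:
  assumes r: "regs_ok (regs s)" and m: "store_ok (mem s) L" and b: "at_walk s L \<nu>"
  shows "progress s \<nu>"
proof -
  obtain V i q where s: "pc s = 33" "regs s 3 = 6 + i" "regs s 10 = B + q" and q: "q \<in> V"
    and J: "search_inv V i L q" and p: "prefix_done V i L" and \<nu>: "\<nu> = 1 + pot L + 2 * (length w - i)"
    using b unfolding at_walk_def by blast
  have "V \<subseteq> R i" using J by (simp add: search_inv_def)
  then have qn: "q \<in> {1..n}" using q R_subset_states by blast
  note c = store_ok_cell[OF m cells(4)[OF qn]]
  show ?thesis
  proof (cases "mem s (B + q) = 0")
    case True
    let ?s = "(step W prog ^^ 2) s"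
    have L: "L (B + q) = []" using c True by simp
    have "mem s (regs s 10) = 0" using s True by simp
    note blk = block_walk_end[OF s(1) r this]
    have "at_drain ?s L (pot L + 2 * (length w - i))"
      using blk s search_inv_walk_end[OF J L] p unfolding at_drain_def
      by (intro exI[of _ V] exI[of _ i]) simp
    then show ?thesis using blk(2,4) \<nu> m by (intro progressI[of 2 ?s L]) auto
  next
    case False
    let ?x = "mem s (B + q)"
    let ?a = "m0 (?x + 1)"
    let ?s = "(step W prog ^^ 11) s"
    obtain xs where L: "L (B + q) = ?x # xs" and x: "?x \<in> insert 2 E" using c(2) False by blast
    have f: "mem s (?x + 1) = ?a" using store_ok_field[OF m x] by simp
    \<comment> \<open>State lists contain only proper transitions. This excludes the extra
      transition 2, whose middle field holds \<open>length ts\<close>, a number that can exceed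
      \<open>sg\<close>.\<close>
    have "?x \<in> set (L (B + q))" using L by simp
    then have xE: "?x \<in> E" using J qn unfolding search_inv_def by blast
    have a: "?a \<le> sg" using edge_address(3)[OF xE] .
    have xB: "?x + 2 < B" using edge_slot[OF x] by simp
    note blk = block_walk[OF s(1) r s(3) refl False xB f a cells(2)[OF qn]]
    let ?L = "L(B + q := xs, C + ?a := ?x # L (C + ?a))"
    have "set (L C) \<subseteq> set (?L C)" using cells(1)[OF qn] by auto
    then have "at_walk ?s ?L (1 + pot ?L + 2 * (length w - i))"
      unfolding at_walk_def
      using blk s q search_inv_walk[OF J q L refl] prefix_done_mono[OF p]
      by (intro exI[of _ V] exI[of _ i] exI[of _ q]) auto
    moreover have "store_ok (mem ?s) ?L"
      using blk(5) store_ok_move[OF m cells(4)[OF qn] cells(5)[OF a] cells(2)[OF qn] L] by simp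
    moreover have "pot ?L < pot L"
      using pot_move[of "B + q" "C + ?a" L, OF cells(4)[OF qn] cells(5)[OF a] cells(2)[OF qn] L] qn
      by (auto simp: weight_def C_def split: if_splits)
    ultimately show ?thesis
      using blk(2) \<nu> by (intro progressI[of 11 ?s ?L]) auto
  qed
qed

lemma progress_move:
  assumes r: "regs_ok (regs s)" and m: "store_ok (mem s) L" and b: "at_move s L \<nu>"
  shows "progress s \<nu>"
proof -
  obtain i where s: "pc s = 48" "regs s 3 = 6 + Suc i" "regs s 10 = C + w ! i"
    and i: "i < length w" and J: "search_inv (R i) (Suc i) L 0"
    and \<nu>: "\<nu> = 1 + pot L + 2 * (length w - Suc i)"
    using b unfolding at_move_def by blast
  let ?a = "w ! i"
  have a: "?a \<in> {1..sg}" using word_symbol[OF i] .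
  then have d: "C + ?a \<in> H" "C + ?a \<noteq> C" using cells(5) by auto
  note c = store_ok_cell[OF m d(1)]
  show ?thesis
  proof (cases "mem s (C + ?a) = 0")
    case True
    let ?s = "(step W prog ^^ 2) s"
    have L: "L (C + ?a) = []" using c True by simp
    have "mem s (regs s 10) = 0" using s True by simp
    note blk = block_move_end[OF s(1) r this]
    have "at_drain ?s L (pot L + 2 * (length w - Suc i))"
      using blk s J search_inv_move_end[OF J refl i L] unfolding at_drain_def
      by (intro exI[of _ "R i"] exI[of _ "Suc i"]) simp
    then show ?thesis using blk(2,4) \<nu> m by (intro progressI[of 2 ?s L]) auto
  next
    case False
    let ?x = "mem s (C + ?a)"
    let ?s = "(step W prog ^^ 8) s"
    obtain xs where L: "L (C + ?a) = ?x # xs" using c(2) False by blast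
    note blk = block_move[OF s(1) r s(3) refl False d(2)]
    let ?L = "L(C + ?a := xs, C := ?x # L C)"
    have "at_move ?s ?L (1 + pot ?L + 2 * (length w - Suc i))"
      unfolding at_move_def using blk s i search_inv_move[OF J order_refl i L]
      by (intro exI[of _ i]) auto
    moreover have "store_ok (mem ?s) ?L"
      using blk(5) store_ok_move[OF m d(1) cells(3) d(2) L] by simp
    moreover have "pot ?L < pot L"
      using pot_move[of "C + ?a" C L, OF d(1) cells(3) d(2) L] a by (simp add: weight_def)
    ultimately show ?thesis
      using blk(2) \<nu> by (intro progressI[of 8 ?s ?L]) auto
  qed
qed

lemma Inv_progress: "Inv s \<nu> \<Longrightarrow> progress s \<nu>"
  unfolding Inv_def using progress_build progress_drain progress_walk progress_move by blast

text \<open>All heads are zero except the worklist, whose only node 2 has a null link. The 3 is the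
  weight 2 of this node plus the 1 for leaving the loop at 17.\<close>

lemma Inv_start:
  "Inv ((step W prog ^^ 17) (start W (encode (w, A, ts)))) (5 * length ts + 2 * length w + 3)"
proof -
  let ?s = "(step W prog ^^ 17) (start W (encode (w, A, ts)))"
  define L where "L = (\<lambda>c. if c = C then [2 :: nat] else [])"
  have h: "chain (mem ?s) (mem ?s c) (L c)" if "c \<in> H" for c
    using that m0_zero edge_slot[of 2] unfolding block_init(5) by (auto simp: L_def H_def)
  have "store_ok (mem ?s) L"
    unfolding store_ok_def heap_def using h unfolding block_init(5)
    by (auto simp: L_def C_def)
  moreover have "pot L = 2"
  proof -
    have "pot L = (\<Sum>c\<in>H. if c = C then 2 else 0)"
      unfolding pot_def by (intro sum.cong) (auto simp: L_def weight_def)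
    then show ?thesis using cells(3) by (simp add: H_def)
  qed
  then have "at_build ?s L (5 * length ts + 2 * length w + 3)"
    unfolding at_build_def
  proof (intro exI[of _ 0] conjI ballI allI impI)
    show "mem ?s (T + 3 * j) = m0 (T + 3 * j)" if "0 \<le> j \<and> j < length ts" for j
      using that unfolding block_init(5) by (auto simp: T_def C_def B_def)
  qed (auto simp: block_init L_def C_def simp del: encode.simps)
  ultimately show ?thesis using block_init(2) unfolding Inv_def by blast
qed

lemma final_R: "final A \<in> R (length w) \<longleftrightarrow> (\<exists>u. subseq u w \<and> u \<in> language A)"
  by (auto simp: R_def sub_reach_def language_def)

text \<open>The 17 initial steps are followed by at most
  \<open>5 * length ts + 2 * length w + 4\<close> rounds of 11 steps each, whence
  \<open>61 = 17 + 11 * 4\<close>.\<close>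

lemma prog_answers:
  "answers_within W prog (encode (w, A, ts)) (61 + 55 * length ts + 22 * length w)
    (\<exists>u. subseq u w \<and> u \<in> language A)"
proof -
  let ?s = "(step W prog ^^ 17) (start W (encode (w, A, ts)))"
  have step: "\<exists>k\<le>11. good ((step W prog ^^ k) s) \<or> (\<exists>\<nu>'<\<nu>. Inv ((step W prog ^^ k) s) \<nu>')"
    if "Inv s \<nu>" for s \<nu>
    using Inv_progress[OF that] by (simp add: progress_def)
  obtain t where t: "t \<le> 11 * (5 * length ts + 2 * length w + 3 + 1)" "good ((step W prog ^^ t) ?s)"
    using run_with_potential[of Inv 11 good "step W prog", OF step Inv_start] by blast
  have "good ((step W prog ^^ (t + 17)) (start W (encode (w, A, ts))))"
    using t(2) by (simp add: funpow_add)
  moreover have "t + 17 \<le> 61 + 55 * length ts + 22 * length w" using t(1) by simp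
  ultimately show ?thesis
    unfolding answers_within_def good_def final_R by blast
qed

end

section \<open>Choice of the word size and the final time bound\<close>

lemma answers_within_mono:
  "answers_within W P xs t b \<Longrightarrow> t \<le> t' \<Longrightarrow> answers_within W P xs t' b"
  unfolding answers_within_def by (meson order_trans)

theorem theorem4p1:
  "decidable_in_time instances encode
     (\<lambda>(w, A, ts). \<exists>u. subseq u w \<and> u \<in> language A)
     (\<lambda>(w, A, ts). length w + card (delta A))"
proof -
  have "answers_within (\<kappa> * floorlog 2 (length (encode x))) prog (encode x)
      (61 * (case x of (w, A, ts) \<Rightarrow> length w + card (delta A)) + 61)
      (case x of (w, A, ts) \<Rightarrow> \<exists>u. subseq u w \<and> u \<in> language A)"
    if "2 \<le> \<kappa>" and "x \<in> instances" for \<kappa> x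
  proof -
    obtain w A ts where x: "x = (w, A, ts)" by (cases x)
    let ?l = "length (encode x)"
    let ?W = "\<kappa> * floorlog 2 ?l"
    have l: "6 \<le> ?l" by (simp add: x)
    have "?l < 2 ^ floorlog 2 ?l" using floorlog_bounds[of ?l 2] l by linarith
    \<comment> \<open>The header alone has 6 cells, so the bit length is at least 3. With
      \<open>\<kappa>\<close> at least 2 this gives 6 bits and, beyond the bit length, the spare bit
      that \<open>wide\<close> requires.\<close>
    have f: "3 \<le> floorlog 2 ?l" using l by (intro floorlog_geI) simp_all
    have "2 * floorlog 2 ?l \<le> ?W" using that(1) by (intro mult_le_mono1)
    with f have "6 \<le> ?W" by linarith
    have "2 * ?l < 2 ^ Suc (floorlog 2 ?l)" using \<open>?l < 2 ^ floorlog 2 ?l\<close> by simp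
    also have "\<dots> \<le> 2 ^ ?W"
      using f \<open>2 * floorlog 2 ?l \<le> ?W\<close> by (intro power_increasing) linarith+
    finally interpret ram_run w A ts ?W
      using that(2) \<open>6 \<le> ?W\<close> by unfold_locales (simp_all add: x del: encode.simps)
    have "61 + 55 * length ts + 22 * length w \<le> 61 * (length w + card (delta A)) + 61"
      by (simp add: card_delta)
    from answers_within_mono[OF prog_answers[unfolded x[symmetric]] this]
    show ?thesis by (simp only: x prod.case)
  qed
  then show ?thesis
    unfolding decidable_in_time_def by (intro exI[of _ prog] exI[of _ 2] exI[of _ 61]) simp
qed

end
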